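(* Let $0<M<\frac{1}{2(2\ln 2-1)}$, let $m\ge1$ and $N\ge 2$ be integers, and put $\psi_m(r)=(1-r^m)\ln(1-r^m)$ (so $\psi_1(r)=(1-r)\ln(1-r)$). Let $r_{m,N}(M)$ be the smallest root in $(0,1)$ of the equation $$r^m-1+2M\left(r^m+r-1+\psi_m(r)+\psi_1(r)-\sum_{n=2}^{N-1}\frac{r^n}{n(n-1)}+\ln 4\right)=0 .$$ Then for every $f=h+\overline{g}\in\mathcal{P}^0_{\mathcal{H}}(M)$ with $h(z)=z+\sum_{n\ge2}a_nz^n$ and $g(z)=\sum_{n\ge2}b_nz^n$, $$|f(z^m)|+\sum_{n=N}^{\infty}|a_n||z|^n\le d\left(f(0),\partial f(\mathbb{D})\right)\qquad\text{for } |z|=r\le r_{m,N}(M).$$ The radius $r_{m,N}(M)$ is best possible: it cannot be replaced by any larger number $R\in(r_{m,N}(M),1)$ so that the inequality still holds for all $f\in\mathcal{P}^0_{\mathcal{H}}(M)$ and all $|z|\le R$.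
   Context: $\mathbb{D}=\{z\in\mathbb{C}:|z|<1\}$. $\mathcal{H}_0$ is the class of complex-valued harmonic mappings $f=h+\overline{g}$ in $\mathbb{D}$ with $h,g$ analytic in $\mathbb{D}$, $h(0)=0$, $h'(0)=1$, $g(0)=0$, $g'(0)=0$; thus $f(z)=z+\sum_{n=2}^{\infty}a_nz^n+\overline{\sum_{n=2}^{\infty}b_nz^n}$. For $M>0$, $$\mathcal{P}^0_{\mathcal{H}}(M)=\{f=h+\overline{g}\in\mathcal{H}_0:\ \operatorname{Re}(zh''(z))>-M+|zg''(z)|\ \text{for all } z\in\mathbb{D}\}.$$ $d(f(0),\partial f(\mathbb{D}))$ denotes the Euclidean distance between $f(0)$ and the boundary of $f(\mathbb{D})$, taken to be given by the formula $d(f(0),\partial f(\mathbb{D}))=\liminf_{|z|\to1}|f(z)-f(0)|$. Empty sums are $0$. *)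

theory Defs
  imports "HOL-Complex_Analysis.Complex_Analysis"
begin

text \<open>Only the values of \<open>f\<close>, \<open>h\<close>, \<open>g\<close> on the unit disc matter; there the decomposition
  \<open>f = h + cnj g\<close> is unique because of the normalisation \<open>g 0 = 0\<close>.\<close>

definition canonical_rep ::
    "(complex \<Rightarrow> complex) \<Rightarrow> (complex \<Rightarrow> complex) \<Rightarrow> (complex \<Rightarrow> complex) \<Rightarrow> bool" where
  "canonical_rep f h g \<longleftrightarrow>
     h holomorphic_on ball 0 1 \<and> g holomorphic_on ball 0 1 \<and>
     (\<forall>z\<in>ball 0 1. f z = h z + cnj (g z)) \<and>
     h 0 = 0 \<and> deriv h 0 = 1 \<and> g 0 = 0 \<and> deriv g 0 = 0"

definition harmonic_H0 :: "(complex \<Rightarrow> complex) set" where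
  "harmonic_H0 = {f. \<exists>h g. canonical_rep f h g}"

definition harmonic_PH0 :: "real \<Rightarrow> (complex \<Rightarrow> complex) set" where
  "harmonic_PH0 M = {f \<in> harmonic_H0. \<exists>h g. canonical_rep f h g \<and>
     (\<forall>z\<in>ball 0 1. Re (z * deriv (deriv h) z) > - M + cmod (z * deriv (deriv g) z))}"

text \<open>The distance from \<open>f 0\<close> to the boundary of the image of the unit disc, given by the formula
  \<open>liminf |f z - f 0|\<close> as \<open>|z|\<close> tends to 1 from below.\<close>

definition boundary_dist :: "(complex \<Rightarrow> complex) \<Rightarrow> ereal" where
  "boundary_dist f = Liminf (filtercomap cmod (at_left 1)) (\<lambda>z. ereal (cmod (f z - f 0)))"

definition psi :: "nat \<Rightarrow> real \<Rightarrow> real" where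
  "psi m r = (1 - r ^ m) * ln (1 - r ^ m)"

definition radius_fun :: "nat \<Rightarrow> nat \<Rightarrow> real \<Rightarrow> real \<Rightarrow> real" where
  "radius_fun m N M r = r ^ m - 1 + 2 * M * (r ^ m + r - 1 + psi m r + psi 1 r
     - (\<Sum>n\<in>{2..<N}. r ^ n / (real n * (real n - 1))) + ln 4)"

definition is_smallest_root :: "(real \<Rightarrow> real) \<Rightarrow> real \<Rightarrow> bool" where
  "is_smallest_root F r \<longleftrightarrow> r \<in> {0<..<1} \<and> F r = 0 \<and> (\<forall>s\<in>{0<..<1}. F s = 0 \<longrightarrow> r \<le> s)"

definition bohr_radius :: "nat \<Rightarrow> nat \<Rightarrow> real \<Rightarrow> real" where
  "bohr_radius m N M = (THE r. is_smallest_root (radius_fun m N M) r)"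

text \<open>The series is summed in \<open>ereal\<close>, so that the inequality includes its convergence.\<close>

definition bohr_inequality_on :: "nat \<Rightarrow> nat \<Rightarrow> real \<Rightarrow> real \<Rightarrow> bool" where
  "bohr_inequality_on m N M R \<longleftrightarrow>
     (\<forall>f\<in>harmonic_PH0 M. \<forall>h g a b. canonical_rep f h g \<longrightarrow>
        (\<forall>z\<in>ball 0 1. (\<lambda>n. a (n + 2) * z ^ (n + 2)) sums (h z - z)) \<longrightarrow>
        (\<forall>z\<in>ball 0 1. (\<lambda>n. b (n + 2) * z ^ (n + 2)) sums g z) \<longrightarrow>
        (\<forall>z. cmod z \<le> R \<longrightarrow>
           ereal (cmod (f (z ^ m))) + (\<Sum>n. ereal (cmod (a (n + N)) * cmod z ^ (n + N)))
             \<le> boundary_dist f))"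

end

theory Submission
  imports Defs
begin

text \<open>For \<open>|c| = 1\<close> the analytic function \<open>F = h + c g\<close> satisfies \<open>Re (z F'') > - M\<close>. The
  Caratheodory coefficient estimate for \<open>z F'' + M\<close> bounds the coefficients of \<open>F\<close>, and the Schwarz
  lemma gives \<open>Re (z F'') \<ge> - 2 M |z| / (1 + |z|)\<close>. Choosing \<open>c\<close> with \<open>|F z| = |h z| + |g z|\<close> yields
  the upper growth bound for \<open>f\<close>; choosing \<open>c = u\<^sup>2\<close> for \<open>z = |z| u\<close> and integrating twice along the
  radius yields the lower one, hence \<open>1 - 2 M (2 ln 2 - 1)\<close> as a lower bound for the boundary
  distance. The radius equation balances these estimates, and the function with
  \<open>h'' = 2 M / (1 - z)\<close> and \<open>g = 0\<close> attains all of them, the boundary distance being approached at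
  \<open>z = -1\<close>.\<close>

section \<open>Estimates for analytic functions with values in a half-plane\<close>

text \<open>On a circle of radius \<open>r\<close>, the \<open>n\<close>-th Fourier coefficient of \<open>f\<close> is \<open>c r\<^sup>n\<close> and the
  \<open>-n\<close>-th vanishes, so \<open>c r\<^sup>n\<close> is also the Fourier coefficient of \<open>2 Re f \<ge> 0\<close>.\<close>

lemma caratheodory_coeff_bound:
  fixes f :: "complex \<Rightarrow> complex"
  assumes holf: "f holomorphic_on ball 0 1"
    and pos: "\<And>z. z \<in> ball 0 1 \<Longrightarrow> 0 \<le> Re (f z)"
    and n: "1 \<le> n"
  shows "cmod ((deriv ^^ n) f 0 / fact n) \<le> 2 * Re (f 0)"
proof -
  define c where "c = (deriv ^^ n) f 0 / fact n"
  have bound: "cmod c * r ^ n \<le> 2 * Re (f 0)" if r: "0 < r" "r < 1" for r :: real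
  proof -
    define e where "e = (\<lambda>t::real. exp (2 * of_real pi * \<i> * of_real t))"
    define w where "w = (\<lambda>t. of_real r * e t)"
    have [simp]: "circlepath 0 r = w"
      by (auto simp: circlepath fun_eq_iff w_def e_def)
    have norm_e: "cmod (e t) = 1" for t
      unfolding e_def by (simp add: norm_exp_eq_Re)
    have e_cnj: "e t * cnj (e t) = 1" for t
      using complex_norm_square[of "e t"] by (simp add: norm_e)
    have w_in: "w t \<in> ball 0 1" for t
      using r by (simp add: w_def norm_mult norm_e)
    have sub: "cball 0 r \<subseteq> ball (0::complex) 1"
      using r by auto
    have e_nz: "e t \<noteq> 0" for t
      using norm_e[of t] by auto
    \<comment> \<open>In Cauchy's formula over the parametrised circle, the factor
      \<open>2 * pi * i * w t\<close> from the velocity cancels one of the \<open>Suc k\<close>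
      powers of \<open>w t\<close>.\<close>
    have cauchy: "((\<lambda>t. q (w t) * (inverse (w t)) ^ k) has_integral (deriv ^^ k) q 0 / fact k) {0..1}"
      if holq: "q holomorphic_on ball 0 1" for q k
    proof -
      have "((\<lambda>u. q u / (u - 0) ^ Suc k) has_contour_integral
              ((2 * pi * \<i>) / fact k * (deriv ^^ k) q 0)) (circlepath 0 r)"
        by (rule Cauchy_has_contour_integral_higher_derivative_circlepath)
          (use r sub holq in \<open>auto intro!: holomorphic_on_imp_continuous_on
             intro: holomorphic_on_subset\<close>)
      then have "((\<lambda>t. q (w t) / w t ^ Suc k * (2 * pi * \<i> * r * e t)) has_integral
                    (2 * pi * \<i>) / fact k * (deriv ^^ k) q 0) {0..1}"
        unfolding has_contour_integral vector_derivative_circlepath by (simp add: e_def)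
      then have "((\<lambda>t. 1 / (2 * pi * \<i>) * (q (w t) / w t ^ Suc k * (2 * pi * \<i> * r * e t))) has_integral
                    1 / (2 * pi * \<i>) * ((2 * pi * \<i>) / fact k * (deriv ^^ k) q 0)) {0..1}"
        by (rule has_integral_mult_right)
      moreover have "1 / (2 * pi * \<i>) * (q (w t) / w t ^ Suc k * (2 * pi * \<i> * r * e t))
                       = q (w t) * (inverse (w t)) ^ k" for t
        using r e_nz[of t] by (simp add: w_def field_simps)
      ultimately show ?thesis
        by simp
    qed
    have I1: "((\<lambda>t. f (w t) * (inverse (w t)) ^ n) has_integral c) {0..1}"
      unfolding c_def by (rule cauchy[OF holf])
    \<comment> \<open>The Fourier coefficient of index \<open>-n\<close> is the value at 0 of an
      analytic function vanishing there, as \<open>n\<close> is positive.\<close>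
    have "(\<lambda>z. f z * z ^ n) holomorphic_on ball 0 1"
      by (intro holomorphic_intros holf)
    from cauchy[OF this, of 0] have "((\<lambda>t. f (w t) * w t ^ n) has_integral 0) {0..1}"
      using n by (simp add: power_0_left)
    then have I2: "((\<lambda>t. cnj (f (w t) * w t ^ n)) has_integral 0) {0..1}"
      using has_integral_cnj[of "\<lambda>t. f (w t) * w t ^ n" 0] by (simp add: o_def)
    \<comment> \<open>The weights \<open>r ^ n\<close> and \<open>inverse (r ^ n)\<close> remove the
      radius from both integrands, so that they share the factor \<open>cnj (e t) ^ n\<close> and
      add up to a multiple of \<open>Re f\<close>.\<close>
    have "((\<lambda>t. f (w t) * (inverse (w t)) ^ n * r ^ n + cnj (f (w t) * w t ^ n) * inverse (r ^ n))
             has_integral (c * r ^ n + 0 * complex_of_real (inverse (r ^ n)))) {0..1}"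
      by (intro has_integral_add has_integral_mult_left I1 I2)
    moreover have "f (w t) * (inverse (w t)) ^ n * r ^ n + cnj (f (w t) * w t ^ n) * inverse (r ^ n)
        = 2 * Re (f (w t)) * cnj (e t) ^ n" for t
    proof -
      have inv: "inverse (e t) = cnj (e t)"
        using e_cnj[of t] by (metis inverse_unique)
      have 1: "(inverse (w t)) ^ n * r ^ n = cnj (e t) ^ n"
      proof -
        have "inverse (w t) * r = cnj (e t)"
          using r by (simp add: w_def inv)
        then show ?thesis
          by (metis of_real_power power_mult_distrib)
      qed
      have 2: "cnj (w t) ^ n * inverse (r ^ n) = cnj (e t) ^ n"
        using r by (simp add: w_def power_mult_distrib)
      have "f (w t) * (inverse (w t)) ^ n * r ^ n + cnj (f (w t) * w t ^ n) * inverse (r ^ n)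
          = f (w t) * ((inverse (w t)) ^ n * r ^ n) + cnj (f (w t)) * (cnj (w t) ^ n * inverse (r ^ n))"
        by (simp add: algebra_simps)
      also have "\<dots> = (f (w t) + cnj (f (w t))) * cnj (e t) ^ n"
        by (simp only: 1 2 distrib_right)
      finally show ?thesis
        by (simp add: complex_add_cnj)
    qed
    ultimately have J: "((\<lambda>t. 2 * Re (f (w t)) * cnj (e t) ^ n) has_integral (c * r ^ n)) {0..1}"
      by simp
    have "((\<lambda>t. f (w t)) has_integral f 0) {0..1}"
      using cauchy[OF holf, of 0] by simp
    then have "((\<lambda>t. 2 * Re (f (w t))) has_integral 2 * Re (f 0)) {0..1}"
      by (intro has_integral_mult_right) (auto dest: has_integral_Re)
    then have "cmod (integral {0..1} (\<lambda>t. 2 * Re (f (w t)) * cnj (e t) ^ n)) \<le> 2 * Re (f 0)"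
      using J pos[OF w_in] integral_norm_bound_integral[of "\<lambda>t. 2 * Re (f (w t)) * cnj (e t) ^ n"
          "{0..1}" "\<lambda>t. 2 * Re (f (w t))"]
      by (auto simp: norm_mult norm_power norm_e has_integral_iff)
    then have "cmod (c * r ^ n) \<le> 2 * Re (f 0)"
      using J by (simp add: has_integral_iff)
    then show ?thesis
      using r by (simp add: norm_mult norm_power)
  qed
  have "((\<lambda>r. cmod c * r ^ n) \<longlongrightarrow> cmod c * 1 ^ n) (at_left 1)"
    by (intro tendsto_intros)
  moreover have "\<forall>\<^sub>F r in at_left (1::real). cmod c * r ^ n \<le> 2 * Re (f 0)"
    using eventually_at_left_real[OF zero_less_one] by eventually_elim (use bound in auto)
  ultimately have "cmod c * 1 ^ n \<le> 2 * Re (f 0)"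
    by (rule tendsto_upperbound) auto
  then show ?thesis
    by (simp add: c_def)
qed

text \<open>The Moebius map \<open>w = f / (f + 2 * M)\<close> sends the half-plane
  \<open>Re > - M\<close> into the unit disc and fixes 0, since |f + 2M|^2 - |f|^2 = 4M (Re f + M).
  The Schwarz lemma bounds \<open>w\<close>, and \<open>f = 2 * M * w / (1 - w)\<close> has its
  least real part on |w| = s at w = -s.\<close>

lemma half_plane_Re_lower_bound:
  fixes f :: "complex \<Rightarrow> complex"
  assumes holf: "f holomorphic_on ball 0 1" and f0: "f 0 = 0" and M: "0 < M"
    and pos: "\<And>z. z \<in> ball 0 1 \<Longrightarrow> - M < Re (f z)"
    and z: "cmod z < 1"
  shows "- (2 * M * cmod z / (1 + cmod z)) \<le> Re (f z)"
proof -
  define w where "w = (\<lambda>z. f z / (f z + 2 * M))"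
  have nz: "f z + 2 * M \<noteq> 0" if "cmod z < 1" for z
  proof
    assume "f z + 2 * M = 0"
    then have "Re (f z) = - 2 * M"
      by (simp add: complex_eq_iff)
    with pos[of z] that M show False by auto
  qed
  have lt: "cmod (f z) < cmod (f z + 2 * M)" if "cmod z < 1" for z
  proof (rule power2_less_imp_less)
    have "0 < 4 * M * (Re (f z) + M)"
      using pos[of z] that M by simp
    then show "(cmod (f z))\<^sup>2 < (cmod (f z + 2 * M))\<^sup>2"
      unfolding cmod_power2 by (simp add: power2_eq_square algebra_simps)
  qed simp
  have wz: "cmod (w z) \<le> cmod z"
  proof (rule Schwarz_Lemma(1))
    show "w holomorphic_on ball 0 1"
      unfolding w_def using nz by (intro holomorphic_intros holf) auto
    show "cmod (w z) < 1" if "cmod z < 1" for z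
      using lt[OF that] nz[OF that] by (simp add: w_def norm_divide)
  qed (use z f0 in \<open>auto simp: w_def\<close>)
  define x s where "x = Re (w z)" and "s = cmod (w z)"
  have s: "0 \<le> s" "s \<le> cmod z" "s < 1" "s + x \<ge> 0"
    using wz z abs_Re_le_cmod[of "w z"] by (auto simp: s_def x_def)
  have w1: "1 - w z \<noteq> 0"
    using s by (auto simp: s_def)
  have d: "f z = of_real (2 * M) * (w z / (1 - w z))"
    using nz[OF z] w1 M by (simp add: w_def divide_simps)
  have "w z / (1 - w z) = inverse (1 - w z) - 1"
    using w1 by (simp add: field_simps)
  then have Re_eq: "Re (w z / (1 - w z)) = (1 - x) / (cmod (1 - w z))\<^sup>2 - 1"
    by (simp add: x_def cmod_power2)
  have n1: "(cmod (1 - w z))\<^sup>2 = 1 - 2 * x + s\<^sup>2"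
    by (simp add: cmod_power2 x_def s_def) (simp add: power2_eq_square algebra_simps)
  have pos1: "0 < 1 - 2 * x + s\<^sup>2"
    unfolding n1[symmetric] using w1 by simp
  \<comment> \<open>The quotient \<open>(1 - x) / (1 - 2 * x + s^2)\<close> should be least at
    \<open>x = - s\<close>, where it equals \<open>1 / (1 + s)\<close>; after clearing denominators
    the difference factors, with sign given by |x| at most s.\<close>
  have "(1 - x) * (1 + s) - (1 - 2 * x + s\<^sup>2) = (s + x) * (1 - s)"
    by (simp add: power2_eq_square algebra_simps)
  also have "\<dots> \<ge> 0"
    using s by simp
  finally have "1 / (1 + s) \<le> (1 - x) / (1 - 2 * x + s\<^sup>2)"
    using pos1 s by (simp add: divide_simps mult.commute) 
  moreover have "1 / (1 + cmod z) \<le> 1 / (1 + s)"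
    using s by (intro divide_left_mono) auto
  ultimately have "1 / (1 + cmod z) - 1 \<le> Re (w z / (1 - w z))"
    unfolding Re_eq n1 by linarith
  then have "2 * M * (1 / (1 + cmod z) - 1) \<le> 2 * M * Re (w z / (1 - w z))"
    using M by (intro mult_left_mono) auto
  moreover have "2 * M * (1 / (1 + cmod z) - 1) = - (2 * M * cmod z / (1 + cmod z))"
    by (simp add: field_simps add_nonneg_eq_0_iff)
  moreover have "Re (f z) = 2 * M * Re (w z / (1 - w z))"
    unfolding d times_complex.sel Re_complex_of_real Im_complex_of_real by simp
  ultimately show ?thesis by linarith
qed

section \<open>Lower growth bound along a radius\<close>

lemma has_real_derivative_Re_ray:
  assumes "(G has_field_derivative D) (at (of_real t * u))"
  shows "((\<lambda>t. Re (c * G (of_real t * u))) has_real_derivative Re (c * D * u)) (at t)"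
proof -
  have "((\<lambda>z. c * G (z * u)) has_field_derivative c * D * u) (at (of_real t))"
    using assms by (auto intro!: derivative_eq_intros DERIV_chain2[of G])
  from has_vector_derivative_real_field[OF this]
  have "((\<lambda>t. Re (c * G (of_real t * u))) has_vector_derivative Re (c * D * u)) (at t)"
    by (rule bounded_linear.has_vector_derivative[OF bounded_linear_Re])
  then show ?thesis
    by (simp add: has_real_derivative_iff_has_vector_derivative)
qed

text \<open>The comparison function has value 0 and slope 1 at 0, like the left-rotated
  \<open>F\<close>, and second derivative \<open>- 2 * M / (1 + t)\<close>, which is the half-plane
  bound for \<open>z * F''\<close> divided by \<open>t\<close>. Two monotonicity arguments then
  compare the functions themselves.\<close>

lemma radial_growth_lower_bound:
  fixes F :: "complex \<Rightarrow> complex"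
  assumes holF: "F holomorphic_on ball 0 1" and F0: "F 0 = 0" "deriv F 0 = 1" and M: "0 < M"
    and re: "\<And>z. z \<in> ball 0 1 \<Longrightarrow> - M < Re (z * deriv (deriv F) z)"
    and u: "cmod u = 1" and t: "0 \<le> t" "t < 1"
  shows "t - 2 * M * ((1 + t) * ln (1 + t) - t) \<le> Re (cnj u * F (of_real t * u))"
proof -
  have hol1: "deriv F holomorphic_on ball 0 1" and hol2: "deriv (deriv F) holomorphic_on ball 0 1"
    using holF by (auto intro!: holomorphic_deriv)
  define \<phi> where "\<phi> = (\<lambda>t. Re (cnj u * F (of_real t * u)) - (t - 2 * M * ((1 + t) * ln (1 + t) - t)))"
  \<comment> \<open>The factor 1 matches the constant \<open>c\<close> of
    \<open>has_real_derivative_Re_ray\<close>: differentiating once turns \<open>cnj u\<close> into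
    \<open>cnj u * u = 1\<close>.\<close>
  define \<phi>' where "\<phi>' = (\<lambda>t. Re (1 * deriv F (of_real t * u)) - (1 - 2 * M * ln (1 + t)))"
  have inb: "of_real s * u \<in> ball 0 1" if "0 \<le> s" "s < 1" for s :: real
    using that u by (simp add: norm_mult)
  have uu: "cnj u * d * u = d" for d
    using complex_norm_square[of u] u by (simp add: mult_ac)
  have D1: "(\<phi> has_real_derivative \<phi>' s) (at s)" if s: "0 \<le> s" "s < 1" for s
  proof -
    have "((\<lambda>s. Re (cnj u * F (of_real s * u))) has_real_derivative
            Re (cnj u * deriv F (of_real s * u) * u)) (at s)"
      by (intro has_real_derivative_Re_ray holomorphic_derivI[OF holF] inb s) auto
    moreover have "((\<lambda>t. t - 2 * M * ((1 + t) * ln (1 + t) - t)) has_real_derivative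
                      1 - 2 * M * ln (1 + s)) (at s)"
      using s by (auto intro!: derivative_eq_intros)
    ultimately show ?thesis
      unfolding \<phi>_def \<phi>'_def uu by (auto intro: DERIV_diff)
  qed
  have D2: "(\<phi>' has_real_derivative Re (u * deriv (deriv F) (of_real s * u)) + 2 * M / (1 + s)) (at s)"
    if s: "0 \<le> s" "s < 1" for s
  proof -
    have "((\<lambda>s. Re (1 * deriv F (of_real s * u))) has_real_derivative
            Re (1 * deriv (deriv F) (of_real s * u) * u)) (at s)"
      by (intro has_real_derivative_Re_ray holomorphic_derivI[OF hol1] inb s) auto
    moreover have "((\<lambda>t. 1 - 2 * M * ln (1 + t)) has_real_derivative - (2 * M / (1 + s))) (at s)"
      using s by (auto intro!: derivative_eq_intros)
    ultimately have "(\<phi>' has_real_derivative Re (1 * deriv (deriv F) (of_real s * u) * u)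
        - (- (2 * M / (1 + s)))) (at s)"
      unfolding \<phi>'_def by (rule DERIV_diff)
    then show ?thesis
      by (simp add: mult_ac)
  qed
  have D2_nonneg: "0 \<le> Re (u * deriv (deriv F) (of_real s * u)) + 2 * M / (1 + s)"
    if s: "0 < s" "s < 1" for s
  proof -
    have "- (2 * M * cmod (of_real s * u) / (1 + cmod (of_real s * u)))
            \<le> Re (of_real s * u * deriv (deriv F) (of_real s * u))"
      by (rule half_plane_Re_lower_bound[where f = "\<lambda>z. z * deriv (deriv F) z"])
        (use re M hol2 inb[of s] s in \<open>auto intro!: holomorphic_intros\<close>)
    moreover have "cmod (of_real s * u) = s"
      using s u by (simp add: norm_mult)
    moreover have "Re (of_real s * u * deriv (deriv F) (of_real s * u))
                     = s * Re (u * deriv (deriv F) (of_real s * u))"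
      by (simp add: mult.assoc)
    ultimately have "0 \<le> s * (Re (u * deriv (deriv F) (of_real s * u)) + 2 * M / (1 + s))"
      by (simp add: distrib_left mult_ac)
    then show ?thesis
      using s by (simp add: zero_le_mult_iff)
  qed
  have nonneg1: "0 \<le> \<phi>' s" if s: "0 \<le> s" "s < 1" for s
  proof (cases "s = 0")
    case False
    have "\<phi>' 0 \<le> \<phi>' s"
    \<comment> \<open>The sign of the second derivative was obtained by dividing by
      \<open>s\<close>, hence only for \<open>s > 0\<close>; continuity takes care of the end point
      0.\<close>
    proof (rule DERIV_nonneg_imp_increasing_open[where f = \<phi>' and a = 0 and b = s])
      show "\<exists>y. DERIV \<phi>' x :> y \<and> 0 \<le> y" if "0 < x" "x < s" for x
        using that s D2[of x] D2_nonneg[of x] by auto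
      show "0 \<le> s"
        by (fact s)
      show "continuous_on {0..s} \<phi>'"
        using s by (intro DERIV_continuous_on[OF DERIV_subset[OF D2]]) auto
    qed
    then show ?thesis
      by (simp add: \<phi>'_def F0)
  qed (simp add: \<phi>'_def F0)
  have "\<phi> 0 \<le> \<phi> t"
  proof (rule DERIV_nonneg_imp_nondecreasing[where f = \<phi> and a = 0 and b = t])
    show "\<exists>y. DERIV \<phi> x :> y \<and> 0 \<le> y" if "0 \<le> x" "x \<le> t" for x
      using that t D1[of x] nonneg1[of x] by auto
  qed (fact t)
  then show ?thesis
    by (simp add: \<phi>_def F0)
qed

section \<open>Coefficient bounds and the upper growth bound\<close>

text \<open>Partial fractions 1/(n(n-1)) = 1/(n-1) - 1/n split the series into
  \<open>- z * Ln (1 - z)\<close> and the logarithmic series without its linear term.\<close>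

lemma sums_powers_over_n_pred:
  fixes z :: complex
  assumes "cmod z < 1"
  shows "(\<lambda>n. z ^ (n + 2) / (of_nat (n + 2) * of_nat (n + 1))) sums (z + (1 - z) * Ln (1 - z))"
proof -
  have "(\<lambda>n. - (z ^ n) / of_nat n) sums Ln (1 - z)"
    using Ln_series'[of "- z"] assms by simp
  then have A: "(\<lambda>n. - (z ^ Suc n) / of_nat (Suc n)) sums Ln (1 - z)"
    by (subst sums_Suc_iff) simp
  then have "(\<lambda>n. - (z ^ Suc (Suc n)) / of_nat (Suc (Suc n))) sums (Ln (1 - z) + z)"
    by (subst sums_Suc_iff) simp
  moreover have "(\<lambda>n. z * (- (z ^ Suc n) / of_nat (Suc n))) sums (z * Ln (1 - z))"
    using A by (rule sums_mult)
  ultimately have "(\<lambda>n. - (z ^ Suc (Suc n)) / of_nat (Suc (Suc n)) - z * (- (z ^ Suc n) / of_nat (Suc n)))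
                     sums (Ln (1 - z) + z - z * Ln (1 - z))"
    by (rule sums_diff)
  moreover have "- (z ^ Suc (Suc n)) / of_nat (Suc (Suc n)) - z * (- (z ^ Suc n) / of_nat (Suc n))
                   = z ^ (n + 2) / (of_nat (n + 2) * of_nat (n + 1))" for n
  proof -
    have "of_nat (Suc (Suc n)) \<noteq> (0::complex)" "of_nat (Suc n) \<noteq> (0::complex)"
      by (simp_all only: of_nat_eq_0_iff)
    then show ?thesis
      by (simp add: divide_simps del: of_nat_Suc) (simp add: algebra_simps)
  qed
  ultimately show ?thesis
    by (simp add: algebra_simps)
qed

lemma sums_powers_over_n_pred_real:
  fixes x :: real
  assumes "0 \<le> x" "x < 1"
  shows "(\<lambda>n. x ^ (n + 2) / (real (n + 2) * real (n + 1))) sums (x + psi 1 x)"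
proof -
  have "Ln (1 - complex_of_real x) = of_real (ln (1 - x))"
    using assms Ln_of_real[of "1 - x"] by simp
  then have "(\<lambda>n. complex_of_real (x ^ (n + 2) / (real (n + 2) * real (n + 1)))) sums of_real (x + psi 1 x)"
    using sums_powers_over_n_pred[of "of_real x"] assms by (simp add: psi_def)
  then show ?thesis
    by (subst (asm) sums_of_real_iff)
qed

text \<open>The function \<open>z * F'' + M\<close> has positive real part and value
  \<open>M\<close> at 0, and its coefficient of index \<open>n + 1\<close> is
  \<open>(n + 2) * (n + 1)\<close> times the coefficient of \<open>F\<close> of index
  \<open>n + 2\<close>.\<close>

lemma half_plane_coeff_bound:
  fixes F :: "complex \<Rightarrow> complex"
  assumes holF: "F holomorphic_on ball 0 1"
    and re: "\<And>z. z \<in> ball 0 1 \<Longrightarrow> - M < Re (z * deriv (deriv F) z)"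
    and P: "F has_fps_expansion P"
  shows "cmod (fps_nth P (n + 2)) \<le> 2 * M / (real (n + 2) * real (n + 1))"
proof -
  define p where "p = (\<lambda>z. z * deriv (deriv F) z + of_real M)"
  have holp: "p holomorphic_on ball 0 1"
    unfolding p_def using holF by (intro holomorphic_intros holomorphic_deriv) auto
  have expp: "p has_fps_expansion fps_X * fps_deriv (fps_deriv P) + fps_const (of_real M)"
    unfolding p_def by (intro fps_expansion_intros P)
  have "cmod ((deriv ^^ Suc n) p 0 / fact (Suc n)) \<le> 2 * Re (p 0)"
    by (rule caratheodory_coeff_bound[OF holp])
      (use less_imp_le[OF re] in \<open>force simp: p_def\<close>)+
  also have "(deriv ^^ Suc n) p 0 / fact (Suc n)
               = fps_nth (fps_X * fps_deriv (fps_deriv P) + fps_const (of_real M)) (Suc n)"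
    by (rule fps_nth_fps_expansion[OF expp, symmetric])
  also have "\<dots> = of_real (real (n + 2) * real (n + 1)) * fps_nth P (n + 2)"
    by (simp add: algebra_simps)
  finally have "real (n + 2) * real (n + 1) * cmod (fps_nth P (n + 2)) \<le> 2 * M"
    unfolding norm_mult norm_of_real by (simp add: p_def)
  then show ?thesis
    by (simp add: pos_le_divide_eq mult_ac del: of_nat_add of_nat_Suc)
qed

lemma has_fps_expansion_disc_sums:
  assumes holF: "F holomorphic_on ball 0 1" and P: "F has_fps_expansion P" and z: "cmod z < 1"
  shows "(\<lambda>n. fps_nth P n * z ^ n) sums F z"
  using has_fps_expansion_imp_sums_complex[of F P 1 z] assms
  by (auto simp: eball_def ball_def)

lemma growth_upper_bound:
  fixes F :: "complex \<Rightarrow> complex"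
  assumes holF: "F holomorphic_on ball 0 1" and F0: "F 0 = 0" "deriv F 0 = 1"
    and re: "\<And>z. z \<in> ball 0 1 \<Longrightarrow> - M < Re (z * deriv (deriv F) z)"
    and z: "cmod z < 1"
  shows "cmod (F z) \<le> cmod z + 2 * M * (cmod z + psi 1 (cmod z))"
proof -
  define P where "P = fps_expansion F 0"
  have P: "F has_fps_expansion P"
    unfolding P_def using holF by (intro has_fps_expansion_fps_expansion) auto
  have P01: "fps_nth P 0 = 0" "fps_nth P 1 = 1"
    by (simp_all add: fps_nth_fps_expansion[OF P] F0)
  have "(\<lambda>n. fps_nth P (n + 2) * z ^ (n + 2)) sums (F z - (\<Sum>i<2. fps_nth P i * z ^ i))"
    by (rule sums_split_initial_segment[OF has_fps_expansion_disc_sums[OF holF P z]])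
  then have s1: "(\<lambda>n. fps_nth P (n + 2) * z ^ (n + 2)) sums (F z - z)"
    using P01 by (simp add: numeral_2_eq_2)
  have s2: "(\<lambda>n. 2 * M * (cmod z ^ (n + 2) / (real (n + 2) * real (n + 1))))
              sums (2 * M * (cmod z + psi 1 (cmod z)))"
    by (intro sums_mult sums_powers_over_n_pred_real) (use z in auto)
  have "cmod (\<Sum>n. fps_nth P (n + 2) * z ^ (n + 2))
          \<le> (\<Sum>n. 2 * M * (cmod z ^ (n + 2) / (real (n + 2) * real (n + 1))))"
  proof (rule norm_suminf_le)
    fix n
    have "cmod (fps_nth P (n + 2)) * cmod z ^ (n + 2)
            \<le> 2 * M / (real (n + 2) * real (n + 1)) * cmod z ^ (n + 2)"
      by (intro mult_right_mono half_plane_coeff_bound[OF holF re P]) auto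
    then show "cmod (fps_nth P (n + 2) * z ^ (n + 2))
            \<le> 2 * M * (cmod z ^ (n + 2) / (real (n + 2) * real (n + 1)))"
      by (simp add: norm_mult norm_power)
  qed (rule sums_summable[OF s2])
  then have "cmod (F z - z) \<le> 2 * M * (cmod z + psi 1 (cmod z))"
    using s1 s2 by (simp add: sums_iff)
  then show ?thesis
    using norm_triangle_ineq2[of "F z" z] by linarith
qed

section \<open>Uniqueness of the decomposition and transfer of the estimates to harmonic
  mappings\<close>

text \<open>With \<open>Re (F 0) = 0\<close> the Caratheodory bound annihilates every coefficient of
  positive index.\<close>

lemma holomorphic_Re_zero_imp_zero:
  assumes "F holomorphic_on ball 0 1" "\<And>z. z \<in> ball 0 1 \<Longrightarrow> Re (F z) = 0" "F 0 = 0"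
    and z: "z \<in> ball 0 1"
  shows "F z = 0"
proof -
  define P where "P = fps_expansion F 0"
  have P: "F has_fps_expansion P"
    unfolding P_def using assms by (intro has_fps_expansion_fps_expansion) auto
  have "fps_nth P n = 0" for n
  proof (cases "n = 0")
    case False
    then show ?thesis
      using caratheodory_coeff_bound[of F n] assms by (simp add: fps_nth_fps_expansion[OF P])
  qed (simp add: fps_nth_fps_expansion[OF P] assms)
  then have "(\<lambda>n. 0) sums F z"
    using has_fps_expansion_disc_sums[OF assms(1) P] z by simp
  then show ?thesis
    by (simp add: sums_iff)
qed

text \<open>If p and q are the differences of the analytic parts, then p + cnj q = 0, so p + q and i
  (p - q) both have zero real part and vanish at 0. Hence both vanish identically.\<close>

lemma canonical_rep_unique:
  assumes 1: "canonical_rep f h g" and 2: "canonical_rep f h' g'" and z: "z \<in> ball 0 1"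
  shows "h z = h' z" "g z = g' z"
proof -
  have eq: "h z - h' z + cnj (g z - g' z) = 0" if "z \<in> ball 0 1" for z
  proof -
    have "h z + cnj (g z) = h' z + cnj (g' z)"
      using 1 2 that unfolding canonical_rep_def by metis
    then show ?thesis
      by (simp add: algebra_simps)
  qed
  have A: "(h z - h' z) + (g z - g' z) = 0"
  proof (rule holomorphic_Re_zero_imp_zero[of "\<lambda>z. (h z - h' z) + (g z - g' z)", OF _ _ _ z])
    fix z :: complex assume "z \<in> ball 0 1"
    from arg_cong[OF eq[OF this], of Re] show "Re (h z - h' z + (g z - g' z)) = 0"
      by simp
  qed (use 1 2 in \<open>auto simp: canonical_rep_def intro!: holomorphic_intros\<close>)
  have B: "\<i> * ((h z - h' z) - (g z - g' z)) = 0"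
  proof (rule holomorphic_Re_zero_imp_zero[of "\<lambda>z. \<i> * ((h z - h' z) - (g z - g' z))", OF _ _ _ z])
    fix z :: complex assume "z \<in> ball 0 1"
    from arg_cong[OF eq[OF this], of Im] show "Re (\<i> * (h z - h' z - (g z - g' z))) = 0"
      by simp
  qed (use 1 2 in \<open>auto simp: canonical_rep_def intro!: holomorphic_intros\<close>)
  from A B show "h z = h' z" "g z = g' z"
    by (auto simp: complex_eq_iff)
qed

text \<open>Membership supplies the inequality for some representation only, whereas the Bohr
  inequality ranges over all of them; uniqueness on the disc carries the second derivatives
  over.\<close>

lemma harmonic_PH0_rep:
  assumes f: "f \<in> harmonic_PH0 M" and rep: "canonical_rep f h g" and z: "z \<in> ball 0 1"
  shows "- M + cmod (z * deriv (deriv g) z) < Re (z * deriv (deriv h) z)"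
proof -
  obtain h' g' where rep': "canonical_rep f h' g'"
    and *: "- M + cmod (z * deriv (deriv g') z) < Re (z * deriv (deriv h') z)"
    using f z unfolding harmonic_PH0_def by auto
  have ev: "\<forall>\<^sub>F w in nhds z. w \<in> ball 0 1"
    using z by (intro eventually_nhds_in_open) auto
  have "(deriv ^^ 2) h z = (deriv ^^ 2) h' z"
    by (rule higher_deriv_cong_ev) (use ev in \<open>auto elim!: eventually_mono
      intro: canonical_rep_unique[OF rep rep']\<close>)
  moreover have "(deriv ^^ 2) g z = (deriv ^^ 2) g' z"
    by (rule higher_deriv_cong_ev) (use ev in \<open>auto elim!: eventually_mono
      intro: canonical_rep_unique[OF rep rep']\<close>)
  ultimately show ?thesis
    using * by (simp add: numeral_2_eq_2)
qed

text \<open>The real part of \<open>c * z * g''\<close> is at least \<open>- cmod (z * g'')\<close>,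
  which is what the defining inequality of the class compensates. All later estimates for
  \<open>f\<close> come from such \<open>F\<close>.\<close>

lemma harmonic_PH0_rotation:
  assumes f: "f \<in> harmonic_PH0 M" and rep: "canonical_rep f h g" and c: "cmod c = 1"
  defines "F \<equiv> \<lambda>z. h z + c * g z"
  shows "F holomorphic_on ball 0 1" "F 0 = 0" "deriv F 0 = 1"
    and "\<And>z. z \<in> ball 0 1 \<Longrightarrow> - M < Re (z * deriv (deriv F) z)"
proof -
  have hol: "h holomorphic_on ball 0 1" "g holomorphic_on ball 0 1"
    "deriv h holomorphic_on ball 0 1" "deriv g holomorphic_on ball 0 1"
    using rep by (auto simp: canonical_rep_def intro!: holomorphic_deriv)
  then show "F holomorphic_on ball 0 1"
    unfolding F_def by (intro holomorphic_intros)
  show "F 0 = 0"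
    using rep by (simp add: F_def canonical_rep_def)
  have d: "deriv (\<lambda>z. p z + c * q z) z = deriv p z + c * deriv q z"
    if "z \<in> ball 0 1" "p holomorphic_on ball 0 1" "q holomorphic_on ball 0 1" for p q z
    using that by (intro DERIV_imp_deriv DERIV_add DERIV_cmult holomorphic_derivI) auto
  have d1: "deriv F z = deriv h z + c * deriv g z" if "z \<in> ball 0 1" for z
    unfolding F_def using that hol by (intro d)
  then show "deriv F 0 = 1"
    using rep by (simp add: canonical_rep_def)
  fix z :: complex assume z: "z \<in> ball 0 1"
  have "deriv (deriv F) z = deriv (\<lambda>z. deriv h z + c * deriv g z) z"
  proof (rule deriv_cong_ev)
    have "\<forall>\<^sub>F w in nhds z. w \<in> ball 0 1"
      using z by (intro eventually_nhds_in_open) auto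
    then show "\<forall>\<^sub>F w in nhds z. deriv F w = deriv h w + c * deriv g w"
      by eventually_elim (rule d1)
  qed simp
  also have "\<dots> = deriv (deriv h) z + c * deriv (deriv g) z"
    using z hol by (intro d)
  finally have "z * deriv (deriv F) z = z * deriv (deriv h) z + c * (z * deriv (deriv g) z)"
    by (simp add: algebra_simps)
  then have "Re (z * deriv (deriv h) z) - cmod (c * (z * deriv (deriv g) z)) \<le> Re (z * deriv (deriv F) z)"
    using abs_Re_le_cmod[of "c * (z * deriv (deriv g) z)"] by simp
  then show "- M < Re (z * deriv (deriv F) z)"
    using harmonic_PH0_rep[OF f rep z] c by (simp add: norm_mult)
qed

lemma harmonic_PH0_lower_bound:
  assumes f: "f \<in> harmonic_PH0 M" and rep: "canonical_rep f h g" and M: "0 < M" and z: "cmod z < 1"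
  shows "cmod z - 2 * M * ((1 + cmod z) * ln (1 + cmod z) - cmod z) \<le> cmod (f z)"
proof (cases "z = 0")
  case False
  define u where "u = sgn z"
  have u: "cmod u = 1" "of_real (cmod z) * u = z"
    using False by (simp_all add: u_def norm_sgn) (simp add: sgn_eq)
  have uu: "cnj u * u = 1"
    using complex_norm_square[of u] u by (simp add: mult.commute)
  \<comment> \<open>the rotation by \<open>u\<^sup>2\<close> turns \<open>Re (cnj u * cnj (g z)) = Re (u * g z)\<close> into a term of \<open>F\<close>\<close>
  have "cmod z - 2 * M * ((1 + cmod z) * ln (1 + cmod z) - cmod z)
          \<le> Re (cnj u * (h (of_real (cmod z) * u) + u\<^sup>2 * g (of_real (cmod z) * u)))"
    by (rule radial_growth_lower_bound[where F = "\<lambda>z. h z + u\<^sup>2 * g z"])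
      (use harmonic_PH0_rotation[OF f rep, of "u\<^sup>2"] u z M in \<open>auto simp: norm_power\<close>)
  also have "\<dots> = Re (cnj u * h z) + Re ((cnj u * u) * (u * g z))"
    unfolding u by (simp only: power2_eq_square plus_complex.sel distrib_left mult.assoc)
  also have "\<dots> = Re (cnj u * f z)"
  proof -
    have "f z = h z + cnj (g z)"
      using rep z by (simp add: canonical_rep_def)
    then show ?thesis
      unfolding uu by (simp add: algebra_simps)
  qed
  also have "\<dots> \<le> cmod (f z)"
    using complex_Re_le_cmod[of "cnj u * f z"] u by (simp add: norm_mult)
  finally show ?thesis .
qed simp

text \<open>Rotating \<open>b\<close> into the direction of \<open>a\<close> gives equality in the
  triangle inequality.\<close>

lemma unimodular_norm_add:
  fixes a b :: complex
  obtains c where "cmod c = 1" "cmod (a + c * b) = cmod a + cmod b"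
proof (cases "a = 0 \<or> b = 0")
  case True
  then show thesis
    by (intro that[of 1]) auto
next
  case False
  have "a + sgn a / sgn b * b = sgn a * of_real (cmod a + cmod b)"
    using False by (simp add: sgn_eq field_simps)
  then have "cmod (a + sgn a / sgn b * b) = cmod (sgn a) * \<bar>cmod a + cmod b\<bar>"
    by (simp only: norm_mult norm_of_real)
  then show thesis
    using False by (intro that[of "sgn a / sgn b"]) (auto simp: norm_divide norm_sgn)
qed

lemma harmonic_PH0_upper_bound:
  assumes f: "f \<in> harmonic_PH0 M" and rep: "canonical_rep f h g" and z: "cmod z < 1"
  shows "cmod (f z) \<le> cmod z + 2 * M * (cmod z + psi 1 (cmod z))"
proof -
  \<comment> \<open>The rotation depends on the point \<open>z\<close>, which is harmless because
    the growth bound is the same for every unimodular \<open>c\<close>.\<close>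
  obtain c where c: "cmod c = 1" "cmod (h z + c * g z) = cmod (h z) + cmod (g z)"
    using unimodular_norm_add .
  have "cmod (f z) \<le> cmod (h z) + cmod (g z)"
    using rep z norm_triangle_ineq[of "h z" "cnj (g z)"] by (simp add: canonical_rep_def)
  also have "\<dots> \<le> cmod z + 2 * M * (cmod z + psi 1 (cmod z))"
    using growth_upper_bound[of "\<lambda>z. h z + c * g z" M z] harmonic_PH0_rotation[OF f rep c(1)] z c(2)
    by auto
  finally show ?thesis .
qed

lemma harmonic_PH0_coeff_bound:
  assumes f: "f \<in> harmonic_PH0 M" and rep: "canonical_rep f h g"
    and a: "\<And>z. z \<in> ball 0 1 \<Longrightarrow> (\<lambda>n. a (n + 2) * z ^ (n + 2)) sums (h z - z)"
    and n: "2 \<le> n"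
  shows "cmod (a n) \<le> 2 * M / (real n * (real n - 1))"
proof -
  \<comment> \<open>The hypothesis constrains \<open>a\<close> only from index 2 on; the
    normalisation of \<open>h\<close> dictates the first two coefficients.\<close>
  define P where "P = Abs_fps (\<lambda>n. if n = 0 then 0 else if n = 1 then 1 else a n)"
  have "h has_fps_expansion P"
  proof (rule has_fps_expansionI)
    have "\<forall>\<^sub>F z in nhds 0. z \<in> ball (0::complex) 1"
      by (intro eventually_nhds_in_open) auto
    then show "\<forall>\<^sub>F z in nhds 0. (\<lambda>n. fps_nth P n * z ^ n) sums h z"
    proof eventually_elim
      case (elim z)
      have "(\<lambda>n. fps_nth P (n + 2) * z ^ (n + 2)) sums (h z - (\<Sum>i<2. fps_nth P i * z ^ i))"
        using a[OF elim] by (simp add: P_def numeral_2_eq_2)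
      then show ?case
        by (subst (asm) sums_iff_shift) simp
    qed
  qed
  moreover have "h holomorphic_on ball 0 1"
    using rep by (simp add: canonical_rep_def)
  moreover have "- M < Re (z * deriv (deriv h) z)" if "z \<in> ball 0 1" for z
    using harmonic_PH0_rep[OF f rep that] norm_ge_zero[of "z * deriv (deriv g) z"] by linarith
  moreover obtain k where k: "n = k + 2"
    using n by (metis le_add_diff_inverse2)
  ultimately have "cmod (fps_nth P n) \<le> 2 * M / (real (k + 2) * real (k + 1))"
    unfolding k by (intro half_plane_coeff_bound)
  then show ?thesis
    using n by (simp add: P_def k algebra_simps)
qed

section \<open>Lower bound for the boundary distance\<close>

lemma boundary_dist_lower_bound:
  assumes f: "f \<in> harmonic_PH0 M" and rep: "canonical_rep f h g" and M: "0 < M"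
  shows "ereal (1 - 2 * M * (2 * ln 2 - 1)) \<le> boundary_dist f"
  unfolding boundary_dist_def le_Liminf_iff
proof (intro allI impI)
  fix y assume y: "y < ereal (1 - 2 * M * (2 * ln 2 - 1))"
  \<comment> \<open>The lower growth bound as a function of |z|; its limit at 1 is the claimed
    constant.\<close>
  define L where "L = (\<lambda>t::real. t - 2 * M * ((1 + t) * ln (1 + t) - t))"
  have "((\<lambda>t. ereal (L t)) \<longlongrightarrow> ereal (1 - 2 * M * ((1 + 1) * ln (1 + 1) - 1))) (at_left 1)"
    unfolding L_def by (intro tendsto_intros) auto
  then have "\<forall>\<^sub>F t in at_left 1. y < ereal (L t)"
    using y by (intro order_tendstoD) auto
  moreover have "\<forall>\<^sub>F t in at_left (1::real). t < 1"
    by (simp add: eventually_at_filter)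
  ultimately have "\<forall>\<^sub>F t in at_left 1. y < ereal (L t) \<and> t < 1"
    by eventually_elim auto
  then have "\<forall>\<^sub>F z in filtercomap cmod (at_left 1). y < ereal (L (cmod z)) \<and> cmod z < 1"
    by (rule eventually_filtercomapI)
  then show "\<forall>\<^sub>F z in filtercomap cmod (at_left 1). y < ereal (cmod (f z - f 0))"
  proof eventually_elim
    case (elim z)
    have "f 0 = 0"
      using rep by (simp add: canonical_rep_def)
    moreover have "L (cmod z) \<le> cmod (f z)"
      unfolding L_def using harmonic_PH0_lower_bound[OF f rep M] elim by auto
    ultimately show ?case
      using elim by (auto intro: less_le_trans)
  qed
qed

section \<open>The radius equation\<close>

lemma sums_tail:
  fixes r :: real
  assumes r: "0 \<le> r" "r < 1" and N: "2 \<le> N"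
  shows "(\<lambda>n. r ^ (n + N) / (real (n + N) * (real (n + N) - 1)))
           sums (r + psi 1 r - (\<Sum>n\<in>{2..<N}. r ^ n / (real n * (real n - 1))))"
proof -
  obtain k where k: "N = k + 2"
    using N by (metis le_add_diff_inverse2)
  define t where "t = (\<lambda>n. r ^ n / (real n * (real n - 1)))"
  have "(\<lambda>n. t (n + 2)) sums (r + psi 1 r)"
    using sums_powers_over_n_pred_real[OF r] by (simp add: t_def add.commute)
  from sums_split_initial_segment[OF this, of k]
  have "(\<lambda>n. t (n + N)) sums (r + psi 1 r - (\<Sum>i<k. t (i + 2)))"
    by (simp add: k)
  also have "(\<Sum>i<k. t (i + 2)) = (\<Sum>n\<in>{2..<N}. t n)"
    using sum.shift_bounds_nat_ivl[of t 0 2 k] by (simp only: k lessThan_atLeast0 add_0)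
  finally show ?thesis
    by (simp add: t_def)
qed

text \<open>Termwise comparison of the series gives monotonicity without differentiating the closed
  form.\<close>

lemma tail_mono:
  assumes r: "0 \<le> r" "r \<le> s" "s < 1" and N: "2 \<le> N"
  shows "r + psi 1 r - (\<Sum>n\<in>{2..<N}. r ^ n / (real n * (real n - 1)))
       \<le> s + psi 1 s - (\<Sum>n\<in>{2..<N}. s ^ n / (real n * (real n - 1)))"
proof (rule sums_le[OF _ sums_tail sums_tail])
  show "r ^ (n + N) / (real (n + N) * (real (n + N) - 1))
          \<le> s ^ (n + N) / (real (n + N) * (real (n + N) - 1))" for n
    using r N by (intro divide_right_mono power_mono) auto
qed (use r N in auto)

lemma tail_nonneg:
  assumes r: "0 \<le> r" "r < 1" and N: "2 \<le> N"
  shows "0 \<le> r + psi 1 r - (\<Sum>n\<in>{2..<N}. r ^ n / (real n * (real n - 1)))"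
proof (rule sums_le)
  show "0 \<le> r ^ (n + N) / (real (n + N) * (real (n + N) - 1))" for n
    using r N by (intro divide_nonneg_nonneg mult_nonneg_nonneg) auto
qed (rule sums_zero, rule sums_tail[OF assms])

lemma psi_power: "psi m r = psi 1 (r ^ m)"
  by (simp add: psi_def)

lemma ln_4: "ln (4::real) = 2 * ln 2"
  using ln_realpow[of 2 2] by simp

text \<open>Regroups the equation by meaning: upper growth bound at \<open>r ^ m\<close>, plus the
  bound for the coefficient tail, minus the lower bound for the boundary distance.\<close>

lemma radius_fun_split:
  "radius_fun m N M r = r ^ m + 2 * M * (r ^ m + psi 1 (r ^ m))
     + 2 * M * (r + psi 1 r - (\<Sum>n\<in>{2..<N}. r ^ n / (real n * (real n - 1))))
     - (1 - 2 * M * (2 * ln 2 - 1))"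
  by (simp add: radius_fun_def psi_power[of m] ln_4 algebra_simps)

lemma radius_fun_strict_mono:
  assumes "0 \<le> r" "r < s" "s < 1" "0 < M" "1 \<le> m" "2 \<le> N"
  shows "radius_fun m N M r < radius_fun m N M s"
proof -
  have "r ^ m < s ^ m"
    using assms by (intro power_strict_mono) auto
  moreover have "s ^ m < 1"
    using assms by (simp add: power_less_one_iff)
  \<comment> \<open>For \<open>N = 2\<close> the sum subtracted in \<open>tail_mono\<close> is
    empty. Strict growth of the whole expression comes from \<open>r ^ m\<close> alone.\<close>
  ultimately have "2 * M * (r ^ m + psi 1 (r ^ m)) \<le> 2 * M * (s ^ m + psi 1 (s ^ m))"
    using tail_mono[of "r ^ m" "s ^ m" 2] assms by (intro mult_left_mono) auto
  moreover have "2 * M * (r + psi 1 r - (\<Sum>n\<in>{2..<N}. r ^ n / (real n * (real n - 1))))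
       \<le> 2 * M * (s + psi 1 s - (\<Sum>n\<in>{2..<N}. s ^ n / (real n * (real n - 1))))"
    using assms by (intro mult_left_mono tail_mono) auto
  ultimately show ?thesis
    using \<open>r ^ m < s ^ m\<close> unfolding radius_fun_split by linarith
qed

lemma two_ln_2_gt_1: "1 < 2 * ln (2::real)"
  using ln2_ge_two_thirds by linarith

lemma radius_fun_root:
  assumes M: "0 < M" "0 < 1 - 2 * M * (2 * ln 2 - 1)" and m: "1 \<le> m" and N: "2 \<le> N"
  shows "\<exists>r. is_smallest_root (radius_fun m N M) r"
proof -
  define F where "F = radius_fun m N M"
  have "F 0 < 0"
    using M m by (simp add: F_def radius_fun_split psi_def power_0_left)
  \<comment> \<open>The two groups with factor \<open>2 * M\<close> are nonnegative, so near 1 it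
    suffices that \<open>t ^ m\<close> exceeds the distance bound; the limit of the difference is
    \<open>2 * M * (2 * ln 2 - 1)\<close>, which is positive.\<close>
  have "((\<lambda>t::real. t ^ m - (1 - 2 * M * (2 * ln 2 - 1)))
          \<longlongrightarrow> 1 ^ m - (1 - 2 * M * (2 * ln 2 - 1))) (at_left 1)"
    by (intro tendsto_intros)
  then have "\<forall>\<^sub>F t in at_left 1. 0 < t ^ m - (1 - 2 * M * (2 * ln 2 - 1))"
    by (rule order_tendstoD) (use M two_ln_2_gt_1 in simp)
  moreover have "\<forall>\<^sub>F t in at_left (1::real). t \<in> {0<..<1}"
    by (rule eventually_at_left_real) simp
  ultimately have "\<forall>\<^sub>F t in at_left 1. 0 < t ^ m - (1 - 2 * M * (2 * ln 2 - 1)) \<and> t \<in> {0<..<1}"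
    by eventually_elim auto
  then obtain t where t: "0 < t ^ m - (1 - 2 * M * (2 * ln 2 - 1))" "0 < t" "t < 1"
    using eventually_happens' [OF trivial_limit_at_left_real] by fastforce
  have "t ^ m < 1"
    using t m by (simp add: power_less_one_iff)
  then have "0 \<le> t ^ m + psi 1 (t ^ m)"
    using tail_nonneg[of "t ^ m" 2] t by simp
  then have "0 < F t"
    using t tail_nonneg[of t N] N M unfolding F_def radius_fun_split
    by (smt (verit) mult_nonneg_nonneg)
  moreover have "continuous_on {0..t} F"
  proof -
    have "1 - s ^ m \<noteq> 0" if "s \<in> {0..t}" for s
      using that t m power_less_one_iff[of s m] by auto
    then show ?thesis
      using t unfolding F_def radius_fun_def psi_def by (auto intro!: continuous_intros)
  qed
  ultimately obtain r where r: "0 \<le> r" "r \<le> t" "F r = 0"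
    using IVT'[of F 0 0 t] \<open>F 0 < 0\<close> t by auto
  have "r \<noteq> 0"
    using r \<open>F 0 < 0\<close> by auto
  moreover have "r \<le> s" if "0 < s" "s < 1" "F s = 0" for s
    using radius_fun_strict_mono[of s r M m N] that r t M m N unfolding F_def by force
  ultimately show ?thesis
    using r t unfolding is_smallest_root_def F_def by (intro exI[of _ r]) auto
qed

lemma is_smallest_root_bohr_radius:
  assumes "is_smallest_root (radius_fun m N M) r"
  shows "bohr_radius m N M = r"
  unfolding bohr_radius_def
  using assms by (intro the_equality) (auto simp: is_smallest_root_def intro!: antisym)

section \<open>The extremal function\<close>

text \<open>Its power series is z plus the sum of 2M/(n(n-1)) z^n over n at least 2, so every
  coefficient bound is attained with a nonnegative coefficient.\<close>

definition extremal :: "real \<Rightarrow> complex \<Rightarrow> complex" where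
  "extremal M z = z + 2 * M * (z + (1 - z) * Ln (1 - z))"

lemma one_minus_notin_nonpos_Reals:
  assumes "cmod z < 1"
  shows "1 - z \<notin> \<real>\<^sub>\<le>\<^sub>0" "1 - z \<noteq> 0"
  using assms abs_Re_le_cmod[of z] by (auto simp: complex_nonpos_Reals_iff)

lemma DERIV_extremal:
  assumes "cmod z < 1"
  shows "(extremal M has_field_derivative 1 - 2 * M * Ln (1 - z)) (at z)"
proof -
  have "((\<lambda>z. (1 - z) * Ln (1 - z)) has_field_derivative - Ln (1 - z) - 1) (at z)"
    using one_minus_notin_nonpos_Reals[OF assms] by (auto intro!: derivative_eq_intros)
  then have "((\<lambda>z. z + 2 * M * (z + (1 - z) * Ln (1 - z))) has_field_derivative
      1 + 2 * M * (1 + (- Ln (1 - z) - 1))) (at z)"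
    by (intro DERIV_add DERIV_ident DERIV_cmult)
  then show ?thesis
    by (simp add: extremal_def[abs_def])
qed

lemma deriv_deriv_extremal:
  assumes "cmod z < 1"
  shows "deriv (deriv (extremal M)) z = 2 * M / (1 - z)"
proof -
  have "\<forall>\<^sub>F w in nhds z. w \<in> ball 0 1"
    using assms by (intro eventually_nhds_in_open) auto
  then have "\<forall>\<^sub>F w in nhds z. deriv (extremal M) w = 1 - 2 * M * Ln (1 - w)"
    by eventually_elim (simp add: DERIV_imp_deriv[OF DERIV_extremal])
  then have "deriv (deriv (extremal M)) z = deriv (\<lambda>w. 1 - 2 * M * Ln (1 - w)) z"
    by (rule deriv_cong_ev) simp
  also have "((\<lambda>w. 1 - 2 * M * Ln (1 - w)) has_field_derivative 2 * M / (1 - z)) (at z)"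
    using one_minus_notin_nonpos_Reals[OF assms] by (auto intro!: derivative_eq_intros simp: field_simps)
  then have "deriv (\<lambda>w. 1 - 2 * M * Ln (1 - w)) z = 2 * M / (1 - z)"
    by (rule DERIV_imp_deriv)
  finally show ?thesis
    by simp
qed

lemma canonical_rep_extremal: "canonical_rep (extremal M) (extremal M) (\<lambda>_. 0)"
proof -
  have "\<exists>f'. (extremal M has_field_derivative f') (at z)" if "z \<in> ball 0 1" for z
    using DERIV_extremal[of z M] that by auto
  then have "extremal M holomorphic_on ball 0 1"
    by (simp add: holomorphic_on_open)
  moreover have "deriv (extremal M) 0 = 1"
    using DERIV_imp_deriv[OF DERIV_extremal[of 0 M]] by simp
  ultimately show ?thesis
    by (simp add: canonical_rep_def extremal_def)
qed

text \<open>Here \<open>z * h'' = M * ((1 + z) / (1 - z) - 1)\<close>, and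
  \<open>(1 + z) / (1 - z)\<close> maps the disc into the right half-plane.\<close>

lemma extremal_in_harmonic_PH0:
  assumes M: "0 < M"
  shows "extremal M \<in> harmonic_PH0 M"
proof -
  have "- M < Re (z * deriv (deriv (extremal M)) z)" if z: "cmod z < 1" for z
  proof -
    have nz: "1 - z \<noteq> 0"
      using z by auto
    have "z * deriv (deriv (extremal M)) z = of_real M * ((1 + z) / (1 - z) - 1)"
      unfolding deriv_deriv_extremal[OF z] using nz by (simp add: divide_simps)
    then have eq: "Re (z * deriv (deriv (extremal M)) z) = M * Re ((1 + z) / (1 - z)) - M"
      by (simp only: times_complex.sel minus_complex.sel Re_complex_of_real Im_complex_of_real)
        (simp add: algebra_simps)
    have "Re ((1 + z) / (1 - z)) = (1 - (cmod z)\<^sup>2) / (cmod (1 - z))\<^sup>2"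
      unfolding Re_divide cmod_power2 by (simp add: power2_eq_square algebra_simps)
    also have "\<dots> > 0"
      using z nz by (intro divide_pos_pos) (auto simp: power_less_one_iff)
    finally show ?thesis
      unfolding eq using M by simp
  qed
  then show ?thesis
    unfolding harmonic_PH0_def harmonic_H0_def using canonical_rep_extremal[of M]
    by (intro CollectI conjI exI[of _ "extremal M"] exI[of _ "\<lambda>_. 0"]) auto
qed

lemma extremal_of_real:
  assumes "x < 1"
  shows "extremal M (of_real x) = of_real (x + 2 * M * (x + psi 1 x))"
proof -
  have "Ln (1 - complex_of_real x) = of_real (ln (1 - x))"
    using assms Ln_of_real[of "1 - x"] by simp
  then show ?thesis
    by (simp add: extremal_def psi_def)
qed

text \<open>A lower limit is bounded above by the limit along any approach to the boundary; the one
  chosen is \<open>- t\<close> with \<open>t\<close> tending to 1.\<close>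

lemma boundary_dist_extremal_le:
  assumes D: "0 < 1 - 2 * M * (2 * ln 2 - 1)"
  shows "boundary_dist (extremal M) \<le> ereal (1 - 2 * M * (2 * ln 2 - 1))"
proof (rule ccontr)
  define L where "L = (\<lambda>t::real. - t + 2 * M * (- t + (1 + t) * ln (1 + t)))"
  assume "\<not> ?thesis"
  then obtain c where c: "ereal (1 - 2 * M * (2 * ln 2 - 1)) < c" "c < boundary_dist (extremal M)"
    using dense not_le by metis
  from less_LiminfD[OF c(2)[unfolded boundary_dist_def]] obtain Q where
    Q: "eventually Q (at_left 1)"
       "\<And>z. Q (cmod z) \<Longrightarrow> c < ereal (cmod (extremal M z - extremal M 0))"
    by (auto simp: eventually_filtercomap)
  have "\<forall>\<^sub>F t in at_left (1::real). t \<in> {0<..<1}"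
    by (rule eventually_at_left_real) simp
  with Q(1) have ev: "\<forall>\<^sub>F t in at_left 1. c \<le> ereal \<bar>L t\<bar>"
  proof eventually_elim
    case (elim t)
    have "extremal M (of_real (- t)) = of_real (L t)"
      using elim by (subst extremal_of_real) (auto simp: L_def psi_def)
    then have "cmod (extremal M (of_real (- t)) - extremal M 0) = \<bar>L t\<bar>"
      by (simp add: extremal_def[of M 0] del: of_real_minus)
    with Q(2)[of "of_real (- t)"] elim show ?case
      by (simp del: of_real_minus add: norm_of_real less_imp_le)
  qed
  \<comment> \<open>The limit inside the absolute value is the negative of the distance bound;
    \<open>D\<close> settles its sign.\<close>
  have "((\<lambda>t. ereal \<bar>L t\<bar>) \<longlongrightarrow> ereal \<bar>- 1 + 2 * M * (- 1 + (1 + 1) * ln (1 + 1))\<bar>) (at_left 1)"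
    unfolding L_def by (intro tendsto_intros) auto
  from tendsto_lowerbound[OF this ev] have "c \<le> ereal (1 - 2 * M * (2 * ln 2 - 1))"
    using D by (simp add: algebra_simps)
  with c(1) show False
    by simp
qed

section \<open>The Bohr inequality and its sharpness\<close>

lemma bohr_inequality_on_bohr_radius:
  assumes M: "0 < M" and m: "1 \<le> m" and N: "2 \<le> N"
    and r: "0 < r" "r < 1" "radius_fun m N M r = 0"
  shows "bohr_inequality_on m N M r"
  unfolding bohr_inequality_on_def
proof (intro ballI allI impI)
  fix f h g a b z
  assume f: "f \<in> harmonic_PH0 M" and rep: "canonical_rep f h g"
    and a: "\<forall>z\<in>ball 0 1. (\<lambda>n. a (n + 2) * z ^ (n + 2)) sums (h z - z)"
    and z: "cmod z \<le> r"
  define s where "s = cmod z"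
  have s: "0 \<le> s" "s \<le> r" "s < 1"
    using z r by (auto simp: s_def)
  define T where "T = s + psi 1 s - (\<Sum>n\<in>{2..<N}. s ^ n / (real n * (real n - 1)))"
  have "(\<Sum>n. ereal (cmod (a (n + N)) * s ^ (n + N)))
          \<le> (\<Sum>n. ereal (2 * M * (s ^ (n + N) / (real (n + N) * (real (n + N) - 1)))))"
  proof (rule suminf_le_pos)
    fix n
    have "cmod (a (n + N)) \<le> 2 * M / (real (n + N) * (real (n + N) - 1))"
      using a N by (intro harmonic_PH0_coeff_bound[OF f rep]) auto
    from mult_right_mono[OF this, of "s ^ (n + N)"] s
    show "ereal (cmod (a (n + N)) * s ^ (n + N))
            \<le> ereal (2 * M * (s ^ (n + N) / (real (n + N) * (real (n + N) - 1))))"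
      by simp
  qed (use s in auto)
  also have "\<dots> = ereal (2 * M * T)"
    using sums_mult[OF sums_tail[OF s(1,3) N], of "2 * M"]
    unfolding T_def sums_ereal[symmetric] by (rule sums_unique[symmetric])
  finally have tail: "(\<Sum>n. ereal (cmod (a (n + N)) * s ^ (n + N))) \<le> ereal (2 * M * T)" .
  have sm: "s ^ m < 1"
    using s m by (simp add: power_less_one_iff)
  have "cmod (f (z ^ m)) \<le> s ^ m + 2 * M * (s ^ m + psi 1 (s ^ m))"
    using harmonic_PH0_upper_bound[OF f rep, of "z ^ m"] sm by (simp add: s_def norm_power)
  \<comment> \<open>Monotonicity extends the balance at the root to all smaller moduli.\<close>
  moreover have "radius_fun m N M s \<le> 0"
    using radius_fun_strict_mono[of s r M m N] s r M m N by (cases "s = r") auto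
  ultimately have "cmod (f (z ^ m)) + 2 * M * T \<le> 1 - 2 * M * (2 * ln 2 - 1)"
    unfolding radius_fun_split T_def by linarith
  then have "ereal (cmod (f (z ^ m))) + ereal (2 * M * T) \<le> ereal (1 - 2 * M * (2 * ln 2 - 1))"
    by simp
  with tail have "ereal (cmod (f (z ^ m))) + (\<Sum>n. ereal (cmod (a (n + N)) * s ^ (n + N)))
      \<le> ereal (1 - 2 * M * (2 * ln 2 - 1))"
    by (meson add_left_mono order_trans)
  also have "\<dots> \<le> boundary_dist f"
    by (rule boundary_dist_lower_bound[OF f rep M])
  finally show "ereal (cmod (f (z ^ m))) + (\<Sum>n. ereal (cmod (a (n + N)) * cmod z ^ (n + N)))
      \<le> boundary_dist f"
    by (simp add: s_def)
qed

text \<open>Tested on \<open>extremal M\<close> at the positive point \<open>R\<close>, the left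
  side equals the sum of the upper estimates, while the boundary distance does not exceed its lower
  bound. Beyond the root this contradicts strict monotonicity.\<close>

lemma bohr_inequality_on_imp_radius_fun_le:
  assumes M: "0 < M" "0 < 1 - 2 * M * (2 * ln 2 - 1)" and m: "1 \<le> m" and N: "2 \<le> N"
    and R: "0 < R" "R < 1" and ineq: "bohr_inequality_on m N M R"
  shows "radius_fun m N M R \<le> 0"
proof -
  define a where "a = (\<lambda>n. complex_of_real (2 * M / (real n * (real n - 1))))"
  define T where "T = R + psi 1 R - (\<Sum>n\<in>{2..<N}. R ^ n / (real n * (real n - 1)))"
  have "(\<lambda>n. a (n + 2) * z ^ (n + 2)) sums (extremal M z - z)" if "z \<in> ball 0 1" for z
  proof -
    have "(\<lambda>n. 2 * of_real M * (z ^ (n + 2) / (of_nat (n + 2) * of_nat (n + 1)))) sums (extremal M z - z)"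
      using sums_mult[OF sums_powers_over_n_pred[of z], of "2 * of_real M"] that
      by (simp add: extremal_def)
    then show ?thesis
      by (simp add: a_def add.commute mult_ac)
  qed
  then have "ereal (cmod (extremal M (of_real R ^ m)))
      + (\<Sum>n. ereal (cmod (a (n + N)) * cmod (of_real R) ^ (n + N))) \<le> boundary_dist (extremal M)"
    using ineq[unfolded bohr_inequality_on_def, rule_format, OF extremal_in_harmonic_PH0[OF M(1)]
        canonical_rep_extremal, of a "\<lambda>_. 0" "of_real R"] R by simp
  also have "(\<lambda>n. cmod (a (n + N)) * cmod (of_real R) ^ (n + N))
      = (\<lambda>n. 2 * M * (R ^ (n + N) / (real (n + N) * (real (n + N) - 1))))"
    using M N R unfolding a_def norm_of_real by (auto simp: abs_mult)
  also have "(\<Sum>n. ereal (2 * M * (R ^ (n + N) / (real (n + N) * (real (n + N) - 1))))) = ereal (2 * M * T)"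
    using sums_mult[OF sums_tail[of R N], of "2 * M"] R N
    unfolding T_def sums_ereal[symmetric] by (intro sums_unique[symmetric]) auto
  also note boundary_dist_extremal_le[OF M(2)]
  finally have le: "cmod (extremal M (of_real R ^ m)) + 2 * M * T \<le> 1 - 2 * M * (2 * ln 2 - 1)"
    by simp
  have "R ^ m < 1"
    using R m by (simp add: power_less_one_iff)
  then have "extremal M (of_real R ^ m) = of_real (R ^ m + 2 * M * (R ^ m + psi 1 (R ^ m)))"
    using extremal_of_real[of "R ^ m" M] by simp
  then have "R ^ m + 2 * M * (R ^ m + psi 1 (R ^ m)) \<le> cmod (extremal M (of_real R ^ m))"
    by (simp only: norm_of_real abs_ge_self)
  with le show ?thesis
    unfolding radius_fun_split T_def by linarith
qed

theorem theorem2p7: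
  fixes M :: real and m N :: nat
  assumes "0 < M" and "M < 1 / (2 * (2 * ln 2 - 1))"
    and "1 \<le> m" and "2 \<le> N"
  shows "is_smallest_root (radius_fun m N M) (bohr_radius m N M) \<and>
         bohr_inequality_on m N M (bohr_radius m N M) \<and>
         (\<forall>R\<in>{bohr_radius m N M<..<1}. \<not> bohr_inequality_on m N M R)"
proof -
  have D: "0 < 1 - 2 * M * (2 * ln 2 - 1)"
    using assms(2) two_ln_2_gt_1 by (simp add: pos_less_divide_eq mult_ac)
  obtain r where r: "is_smallest_root (radius_fun m N M) r"
    using radius_fun_root[OF assms(1) D assms(3,4)] by blast
  then have r': "0 < r" "r < 1" "radius_fun m N M r = 0"
    by (auto simp: is_smallest_root_def)
  have "\<not> bohr_inequality_on m N M R" if "R \<in> {r<..<1}" for R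
    using bohr_inequality_on_imp_radius_fun_le[OF assms(1) D assms(3,4), of R]
      radius_fun_strict_mono[of r R M m N] r' that assms by auto
  then show ?thesis
    unfolding is_smallest_root_bohr_radius[OF r]
    using r bohr_inequality_on_bohr_radius[OF assms(1,3,4) r'] by blast
qed

end
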